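(* Let $\mathcal{C}\subseteq\mathbb{F}_q^n$ be a linear code of length $n$, dimension $k\ge1$ and minimum distance $d\ge2$, with rate satisfying $\frac{k}{n}>\big(1-\frac{1}{\sqrt n}\big)^2$, and let $J=n-k-d+2$. For $\theta\in[0,d-2]$ put $a_\theta=n-\theta+J-J\lceil\frac{n-\theta}{J}\rceil$. Then the average locality of $\mathcal{C}$ satisfies $$\overline{r}\ \ge\ \frac{1}{n}\min_{\theta\in[0,d-2]}\left\{(J-a_\theta)\Big\lfloor\frac{n-\theta}{J}\Big\rfloor^2+a_\theta\Big\lceil\frac{n-\theta}{J}\Big\rceil^2+(n-dJ+2J)\theta\right\}-1 .$$
   Context: For a codeword $\mathbf{y}=(y_1,\dots,y_n)\in\mathcal{C}$, the locality $\mathrm{Loc}(y_i)$ of the $i$-th symbol is the smallest size of a set $\mathcal{I}\subseteq[1,n]\setminus\{i\}$ such that there are scalars $\alpha_l\in\mathbb{F}_q$ with $y_i=\sum_{l\in\mathcal{I}}\alpha_l y_l$ for every codeword $\mathbf{y}\in\mathcal{C}$. The average locality is $\overline{r}=\frac1n\sum_{i=1}^n\mathrm{Loc}(y_i)$. $[a,b]=\{a,\dots,b\}$. *)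

theory Defs
  imports "HOL-Analysis.Analysis"
begin

text \<open>Linear codes of length n = CARD('n) over a finite field 'a, as subspaces of 'a^'n.
  Coordinates are indexed by the finite type 'n (playing the role of [1,n]).\<close>

definition hamming_weight :: "'a::zero ^ 'n \<Rightarrow> nat" where
  "hamming_weight y = card {i. y $ i \<noteq> 0}"

definition min_distance :: "('a::field ^ 'n) set \<Rightarrow> nat" where
  "min_distance C = Min {hamming_weight y | y. y \<in> C \<and> y \<noteq> 0}"

definition locality :: "('a::field ^ 'n) set \<Rightarrow> 'n \<Rightarrow> nat" where
  "locality C i = (LEAST r. \<exists>I. I \<subseteq> UNIV - {i} \<and> card I = r \<and>
      (\<exists>\<alpha> :: 'n \<Rightarrow> 'a. \<forall>y\<in>C. y $ i = (\<Sum>l\<in>I. \<alpha> l * y $ l)))"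

definition avg_locality :: "('a::field ^ 'n) set \<Rightarrow> real" where
  "avg_locality C = (\<Sum>i\<in>(UNIV::'n set). real (locality C i)) / real CARD('n)"

end

theory Submission
  imports Defs
begin

text \<open>
  Let \<open>w i = locality C i + 1\<close> be the size of a smallest parity check through \<open>i\<close>, and pick
  checks \<open>R\<^sub>1, R\<^sub>2, \<dots>\<close> greedily, each through a not yet covered symbol of least \<open>w\<close>. Any \<open>J\<close> of
  them are independent, so by the minimum distance their union misses at most \<open>D = d - 2\<close> symbols.
  Let \<open>R\<^sub>j\<close> have size \<open>w\<^sub>j\<close> and cover \<open>s\<^sub>j\<close> new symbols, let \<open>T = \<Sum>\<^sub>j (w\<^sub>j - s\<^sub>j)\<close> over the first
  \<open>J\<close> checks, let \<open>\<theta>\<close> be the number of symbols these leave uncovered, and let \<open>v\<close> be the size of the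
  next check. Then \<open>\<Sum>\<^sub>i w i \<ge> \<Sum>\<^sub>j s\<^sub>j w\<^sub>j + \<theta> v\<close>.

  If \<open>T \<ge> \<theta>\<close>, the leftover symbols may be moved into the first \<open>J\<close> groups without raising the cost,
  which gives the bound at \<open>0\<close>. Otherwise the bound holds at \<open>\<theta>\<close>: dropping any one of the \<open>J + 1\<close> checks
  leaves at most \<open>D\<close> symbols uncovered, so each of the first \<open>J\<close> has at most \<open>min D s\<^sub>j\<close> private
  symbols. Hence \<open>n \<le> v + T + \<Sum>\<^sub>j min D s\<^sub>j\<close>, and the possible deficit of \<open>v\<close> against \<open>n - D J\<close> is
  paid for by the surplus of \<open>\<Sum>\<^sub>j s\<^sub>j w\<^sub>j\<close> over \<open>\<Sum>\<^sub>j s\<^sub>j\<^sup>2\<close>. (The covering inequality needs some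
  \<open>s\<^sub>j \<ge> D\<close>; if all \<open>s\<^sub>j \<le> D\<close>, then \<open>v \<ge> n - D J\<close> follows from \<open>J v \<ge> n - \<theta>\<close>.)
\<close>

section \<open>Information sets and the Singleton bound\<close>

text \<open>Zeroing outside \<open>Q\<close>, rather than shortening vectors, keeps the image in
  \<open>'a ^ 'n\<close>.\<close>

definition restrict_coords :: "'n set \<Rightarrow> 'a::zero ^ 'n \<Rightarrow> 'a ^ 'n" where
  "restrict_coords Q y = (\<chi> i. if i \<in> Q then y $ i else 0)"

lemma linear_restrict_coords:
  "Vector_Spaces.linear (*s) (*s) (restrict_coords Q :: 'a::field ^ 'n \<Rightarrow> 'a ^ 'n)"
  by unfold_locales (simp_all add: restrict_coords_def vec_eq_iff distrib_left)

lemma inj_on_restrict_coords: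
  fixes C :: "('a::field ^ 'n) set"
  assumes "vec.subspace C"
    and "\<And>y. y \<in> C \<Longrightarrow> \<forall>i\<in>Q. y $ i = 0 \<Longrightarrow> y = 0"
  shows "inj_on (restrict_coords Q) C"
proof (rule inj_onI)
  fix x y assume xy: "x \<in> C" "y \<in> C" "restrict_coords Q x = restrict_coords Q y"
  have "x $ i = y $ i" if "i \<in> Q" for i
    using arg_cong[OF xy(3), of "\<lambda>z. z $ i"] that by (simp add: restrict_coords_def)
  then have "x - y = 0"
    using assms(2)[of "x - y"] vec.subspace_diff[OF assms(1) xy(1,2)] by simp
  then show "x = y" by simp
qed

text \<open>Projection to \<open>Q\<close> is injective on \<open>C\<close>, so \<open>C\<close>
  embeds in a coordinate subspace of dimension \<open>card Q\<close>.\<close>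

lemma dim_le_card_information_set:
  fixes C :: "('a::field ^ 'n) set"
  assumes "vec.subspace C"
    and "\<And>y. y \<in> C \<Longrightarrow> \<forall>i\<in>Q. y $ i = 0 \<Longrightarrow> y = 0"
  shows "vec.dim C \<le> card Q"
proof -
  have span: "vec.span C = C"
    by (simp add: assms(1))
  have "vec.dim C = vec.dim (restrict_coords Q ` C)"
    using vec.dim_image_eq[OF linear_restrict_coords, of Q C]
      inj_on_restrict_coords[OF assms] unfolding span by simp
  also have "\<dots> \<le> vec.dim {x :: 'a ^ 'n. \<forall>i. i \<notin> Q \<longrightarrow> x $ i = 0}"
    by (rule vec.dim_subset) (auto simp: restrict_coords_def)
  also have "\<dots> = card Q"
    by (rule dim_substandard_cart)
  finally show ?thesis .
qed

lemma min_distance_le_hamming_weight: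
  fixes C :: "('a::field ^ 'n) set"
  assumes "y \<in> C" "y \<noteq> 0"
  shows "min_distance C \<le> hamming_weight y"
proof -
  have "{hamming_weight y | y. y \<in> C \<and> y \<noteq> 0} \<subseteq> {..CARD('n)}"
    by (auto simp: hamming_weight_def intro: card_mono)
  then have "finite {hamming_weight y | y. y \<in> C \<and> y \<noteq> 0}"
    by (rule finite_subset) simp
  then show ?thesis
    unfolding min_distance_def using assms by (intro Min_le) auto
qed

lemma codeword_eq_0_if_zeros:
  fixes C :: "('a::field ^ 'n) set"
  assumes "y \<in> C" "\<forall>i\<in>S. y $ i = 0" "CARD('n) < card S + min_distance C"
  shows "y = 0"
proof (rule ccontr)
  assume "y \<noteq> 0"
  have "hamming_weight y \<le> card (- S)"
    unfolding hamming_weight_def using assms(2) by (intro card_mono) auto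
  also have "\<dots> = CARD('n) - card S"
    by (simp add: Compl_eq_Diff_UNIV card_Diff_subset)
  finally show False
    using min_distance_le_hamming_weight[OF assms(1) \<open>y \<noteq> 0\<close>] assms(3)
      card_mono[of "UNIV :: 'n set" S] by simp
qed

text \<open>The dimension hypothesis supplies a nonzero codeword; for the zero code
  \<open>min_distance\<close> is the \<open>Min\<close> of an empty set.\<close>

lemma min_distance_le_length:
  fixes C :: "('a::field ^ 'n) set"
  assumes "1 \<le> vec.dim C"
  shows "min_distance C \<le> CARD('n)"
proof -
  have "\<not> C \<subseteq> {0}"
    using assms unfolding vec.dim_eq_0[symmetric] by linarith
  then obtain y where "y \<in> C" "y \<noteq> 0" by auto
  from min_distance_le_hamming_weight[OF this] show ?thesis
    by (rule order_trans) (auto simp: hamming_weight_def intro: card_mono)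
qed

text \<open>Any \<open>n + 1 - d\<close> coordinates determine a codeword. This later gives
  \<open>J \<ge> 1\<close>.\<close>

lemma singleton_bound:
  fixes C :: "('a::field ^ 'n) set"
  assumes "vec.subspace C" "1 \<le> vec.dim C" "1 \<le> min_distance C"
  shows "vec.dim C + min_distance C \<le> CARD('n) + 1"
proof -
  obtain S :: "'n set" where S: "card S = CARD('n) + 1 - min_distance C"
    using obtain_subset_with_card_n[of "CARD('n) + 1 - min_distance C" "UNIV :: 'n set"] assms(3)
    by fastforce
  have "vec.dim C \<le> card S"
    using S min_distance_le_length[OF assms(2)]
    by (intro dim_le_card_information_set[OF assms(1)] codeword_eq_0_if_zeros) auto
  then show ?thesis
    using S min_distance_le_length[OF assms(2)] by simp
qed

section \<open>Repair sets and parity checks\<close>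

text \<open>As \<open>d \<ge> 2\<close>, deleting coordinate \<open>i\<close> is injective on
  \<open>C\<close>, and a linear left inverse expresses symbol \<open>i\<close> by the others. Hence
  the \<open>LEAST\<close> in \<open>locality\<close> is attained.\<close>

lemma repair_set_exists:
  fixes C :: "('a::field ^ 'n) set"
  assumes "vec.subspace C" "2 \<le> min_distance C"
  shows "\<exists>I. I \<subseteq> UNIV - {i} \<and> card I = locality C i \<and>
    (\<exists>\<alpha> :: 'n \<Rightarrow> 'a. \<forall>y\<in>C. y $ i = (\<Sum>l\<in>I. \<alpha> l * y $ l))"
proof -
  let ?f = "restrict_coords (UNIV - {i}) :: 'a ^ 'n \<Rightarrow> 'a ^ 'n"
  have "inj_on ?f C"
    using assms(2)
    by (intro inj_on_restrict_coords[OF assms(1)] codeword_eq_0_if_zeros)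
      (auto simp: card_Diff_singleton)
  then obtain g where g: "Vector_Spaces.linear (*s) (*s) g" "\<forall>v\<in>C. g (?f v) = v"
    using vec.linear_exists_left_inverse_on[OF linear_restrict_coords assms(1)] by blast
  have "y $ i = (\<Sum>l\<in>UNIV - {i}. g (axis l 1) $ i * y $ l)" if "y \<in> C" for y
  proof -
    have "y $ i = g (?f y) $ i" using g that by simp
    also have "\<dots> = (\<Sum>l\<in>UNIV. ?f y $ l * g (axis l 1) $ i)"
      by (rule linear_componentwise[OF g(1)])
    also have "\<dots> = (\<Sum>l\<in>UNIV - {i}. g (axis l 1) $ i * y $ l)"
      by (rule sum.mono_neutral_cong_right) (auto simp: restrict_coords_def)
    finally show ?thesis .
  qed
  then have "\<exists>r I. I \<subseteq> UNIV - {i} \<and> card I = r \<and>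
      (\<exists>\<alpha> :: 'n \<Rightarrow> 'a. \<forall>y\<in>C. y $ i = (\<Sum>l\<in>I. \<alpha> l * y $ l))"
    by (intro exI[of _ "card (UNIV - {i})"] exI[of _ "UNIV - {i}"] conjI
        exI[of _ "\<lambda>l. g (axis l 1) $ i"]) auto
  then show ?thesis
    unfolding locality_def by (rule LeastI_ex)
qed

text \<open>The parity check behind \<open>R (p j)\<close> recovers the symbol \<open>p j\<close> from symbols
  that are either no pivots or earlier pivots, so all \<open>card K\<close> pivots are redundant.\<close>

lemma card_union_parity_checks:
  fixes C :: "('a::field ^ 'n) set" and K :: "nat set"
  assumes C: "vec.subspace C" "1 \<le> vec.dim C" "1 \<le> min_distance C"
    and R: "\<And>i. i \<in> R i"
    and rec: "\<And>i y. y \<in> C \<Longrightarrow> \<forall>l\<in>R i - {i}. y $ l = 0 \<Longrightarrow> y $ i = 0"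
    and K: "finite K" "card K + vec.dim C + min_distance C = CARD('n) + 2"
    and pivot: "\<And>i j. i \<in> K \<Longrightarrow> j \<in> K \<Longrightarrow> i < j \<Longrightarrow> p j \<notin> R (p i)"
  shows "CARD('n) + 2 \<le> card (\<Union>j\<in>K. R (p j)) + min_distance C"
proof (rule ccontr)
  assume "\<not> ?thesis"
  \<comment> \<open>Padding to \<open>n + 1 - d\<close> coordinates makes \<open>S\<close> determine
    codewords; without the redundant pivots only \<open>k - 1\<close> coordinates would still do
    so.\<close>
  then obtain S where S: "(\<Union>j\<in>K. R (p j)) \<subseteq> S" "card S = CARD('n) + 1 - min_distance C"
    using exists_subset_between[of "\<Union>j\<in>K. R (p j)" "CARD('n) + 1 - min_distance C" UNIV] C(3)
    by fastforce
  have "inj_on p K"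
    by (rule linorder_inj_onI') (metis R pivot)
  then have P: "card (p ` K) = card K" by (rule card_image)
  have sub: "p ` K \<subseteq> S" using S(1) R by blast
  have "vec.dim C \<le> card (S - p ` K)"
  proof (rule dim_le_card_information_set[OF C(1)])
    fix y assume y: "y \<in> C" "\<forall>i\<in>S - p ` K. y $ i = 0"
    have "y $ p j = 0" if "j \<in> K" for j
      using that
    proof (induction j rule: less_induct)
      case (less j)
      show ?case
      proof (rule rec[OF y(1)], rule ballI)
        fix l assume l: "l \<in> R (p j) - {p j}"
        show "y $ l = 0"
        proof (cases "l \<in> p ` K")
          case True
          then obtain i where "i \<in> K" "l = p i" by auto
          then show ?thesis
            using less l pivot[of j i] by (cases i j rule: linorder_cases) auto
        next
          case False
          then show ?thesis using y(2) l S(1) less.prems by auto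
        qed
      qed
    qed
    then have "\<forall>i\<in>S. y $ i = 0" using y(2) by auto
    then show "y = 0"
      using S(2) min_distance_le_length[OF C(2)]
      by (intro codeword_eq_0_if_zeros[OF y(1)]) auto
  qed
  also have "\<dots> = card S - card K"
    using sub P by (simp add: card_Diff_subset)
  finally show False
    using S(2) K(2) C(2) min_distance_le_length[OF C(2)] by simp
qed

section \<open>Greedy choice of checks\<close>

text \<open>Each choice depends on all earlier ones, so the recursion builds the covered set. Once
  everything is covered the choice is arbitrary, hence the conditional form.\<close>

lemma greedy_sequence_exists:
  fixes w :: "'n::finite \<Rightarrow> nat" and R :: "'n \<Rightarrow> 'n set"
  shows "\<exists>p :: nat \<Rightarrow> 'n. \<forall>j x. x \<notin> (\<Union>i<j. R (p i)) \<longrightarrow>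
    p j \<notin> (\<Union>i<j. R (p i)) \<and> w (p j) \<le> w x"
proof -
  define pick where "pick X = (ARG_MIN w x. x \<notin> X)" for X
  define U where "U = rec_nat {} (\<lambda>_ X. X \<union> R (pick X))"
  have U: "U j = (\<Union>i<j. R (pick (U i)))" for j
    by (induction j) (auto simp: U_def lessThan_Suc)
  have "pick X \<notin> X \<and> w (pick X) \<le> w x" if "x \<notin> X" for x X
    using arg_min_nat_lemma[of "\<lambda>x. x \<notin> X" x w] that unfolding pick_def by blast
  then show ?thesis
    by (intro exI[of _ "\<lambda>j. pick (U j)"]) (simp flip: U)
qed

section \<open>Integer optimisation of group sizes\<close>

text \<open>The most even split of \<open>N\<close> has \<open>a\<close> parts equal to the ceiling
  and the others equal to the floor.\<close>

lemma balanced_square_sum_le: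
  fixes s :: "nat \<Rightarrow> int" and J :: nat and N :: int
  assumes J: "J \<ge> 1" and s: "(\<Sum>j<J. s j) = N"
  defines "a \<equiv> N + int J - int J * \<lceil>real_of_int N / real J\<rceil>"
  shows "(int J - a) * \<lfloor>real_of_int N / real J\<rfloor>\<^sup>2 + a * \<lceil>real_of_int N / real J\<rceil>\<^sup>2
    \<le> (\<Sum>j<J. (s j)\<^sup>2)"
proof -
  define q where "q = \<lfloor>real_of_int N / real J\<rfloor>"
  \<comment> \<open>The chord of the square through \<open>q\<close> and \<open>q + 1\<close> lies
    below it at every integer, as none is strictly between.\<close>
  have tangent: "(2 * q + 1) * x - q * (q + 1) \<le> x\<^sup>2" for x :: int
  proof -
    have "0 \<le> (x - q) * (x - q - 1)"
      by (cases "x \<le> q") (auto intro: mult_nonneg_nonneg mult_nonpos_nonpos)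
    then show ?thesis by (simp add: algebra_simps power2_eq_square)
  qed
  have "(2 * q + 1) * N - int J * (q * (q + 1)) = (\<Sum>j<J. (2 * q + 1) * s j - q * (q + 1))"
    by (simp add: sum_subtractf s flip: sum_distrib_left)
  also have "\<dots> \<le> (\<Sum>j<J. (s j)\<^sup>2)"
    by (intro sum_mono tangent)
  finally have *: "(2 * q + 1) * N - int J * (q * (q + 1)) \<le> (\<Sum>j<J. (s j)\<^sup>2)" .
  show ?thesis
  proof (cases "real_of_int N / real J \<in> \<int>")
    case True
    then have c: "\<lceil>real_of_int N / real J\<rceil> = q" and "real_of_int q = real_of_int N / real J"
      by (auto simp: q_def elim: Ints_cases)
    then have "real_of_int N = real_of_int (int J * q)"
      using J by simp
    then have "N = int J * q" by linarith
    then show ?thesis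
      using * c unfolding a_def q_def[symmetric] by (simp add: algebra_simps power2_eq_square)
  next
    case False
    then have c: "\<lceil>real_of_int N / real J\<rceil> = q + 1"
      unfolding q_def by (simp add: ceiling_altdef) (metis Ints_of_int)
    show ?thesis
      using * c unfolding a_def q_def[symmetric] by (simp add: algebra_simps power2_eq_square)
  qed
qed

lemma sum_interpolation:
  fixes s w :: "nat \<Rightarrow> int"
  assumes "\<And>j. j < J \<Longrightarrow> s j \<le> w j" "(\<Sum>j<J. s j) \<le> N" "N \<le> (\<Sum>j<J. w j)"
  shows "\<exists>s'. (\<forall>j<J. s j \<le> s' j \<and> s' j \<le> w j) \<and> (\<Sum>j<J. s' j) = N"
  using assms
proof (induction J arbitrary: N)
  case (Suc J)
  \<comment> \<open>The least last entry that lets the others reach the remaining total.\<close>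
  define x where "x = max (s J) (N - (\<Sum>j<J. w j))"
  have "(\<Sum>j<J. s j) \<le> (\<Sum>j<J. w j)" using Suc.prems(1) by (intro sum_mono) auto
  then have x: "s J \<le> x" "x \<le> w J" "(\<Sum>j<J. s j) \<le> N - x" "N - x \<le> (\<Sum>j<J. w j)"
    using Suc.prems by (auto simp: x_def)
  then obtain s' where "\<forall>j<J. s j \<le> s' j \<and> s' j \<le> w j" "(\<Sum>j<J. s' j) = N - x"
    using Suc.IH[of "N - x"] Suc.prems(1) by auto
  then show ?case
    using x by (intro exI[of _ "s'(J := x)"]) (auto simp: less_Suc_eq)
qed simp

lemma group_cost_lower_bound:
  fixes s w :: "nat \<Rightarrow> int" and \<theta> D v n :: int
  assumes J: "J \<ge> 1"
    and sw: "\<And>j. j < J \<Longrightarrow> 0 \<le> s j \<and> s j \<le> w j \<and> w j \<le> v"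
    and sum_s: "(\<Sum>j<J. s j) = n - \<theta>" and \<theta>: "0 \<le> \<theta>" "\<theta> \<le> D"
    and cover: "\<exists>j<J. D \<le> s j \<Longrightarrow> n \<le> v + (\<Sum>j<J. w j - s j) + (\<Sum>j<J. min D (s j))"
  shows "\<exists>\<theta>' s'. \<theta>' \<in> {0, \<theta>} \<and> (\<Sum>j<J. s' j) = n - \<theta>' \<and>
    (\<Sum>j<J. (s' j)\<^sup>2) + (n - D * int J) * \<theta>' \<le> (\<Sum>j<J. s j * w j) + v * \<theta>"
proof -
  consider (slack) "\<theta> \<le> (\<Sum>j<J. w j - s j)"
    | (tight) "(\<Sum>j<J. w j - s j) \<le> \<theta>" "\<exists>j<J. D \<le> s j"
    | (small) "\<forall>j<J. s j \<le> D"
    by fastforce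
  then show ?thesis
  proof cases
    case slack
    \<comment> \<open>Moving the \<open>\<theta>\<close> remaining symbols into unfilled groups does not increase the cost.\<close>
    then obtain s' where s': "\<forall>j<J. s j \<le> s' j \<and> s' j \<le> w j" "(\<Sum>j<J. s' j) = n"
      using sum_interpolation[of J s w n] sw sum_s \<theta> by (auto simp: sum_subtractf)
    have "(\<Sum>j<J. (s' j)\<^sup>2) \<le> (\<Sum>j<J. s j * w j + (s' j - s j) * v)"
    proof (intro sum_mono)
      fix j assume "j \<in> {..<J}"
      then have j: "0 \<le> s j" "s j \<le> s' j" "s' j \<le> w j" "w j \<le> v" using sw s' by auto
      have "(s' j)\<^sup>2 \<le> s' j * w j"
        unfolding power2_eq_square using j by (intro mult_left_mono) auto
      also have "\<dots> = s j * w j + (s' j - s j) * w j" by (simp add: algebra_simps)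
      also have "\<dots> \<le> s j * w j + (s' j - s j) * v"
        using j by (intro add_left_mono mult_left_mono) auto
      finally show "(s' j)\<^sup>2 \<le> s j * w j + (s' j - s j) * v" .
    qed
    also have "\<dots> = (\<Sum>j<J. s j * w j) + v * \<theta>"
      using s'(2) sum_s by (simp add: sum.distrib sum_subtractf flip: sum_distrib_right)
    finally show ?thesis
      using s'(2) by (intro exI[of _ 0] exI[of _ s']) simp
  next
    case tight
    \<comment> \<open>Equivalent to \<open>(\<theta> - s j) * (w j - s j) \<le> \<theta> * (D - min
      D (s j))\<close>: the surplus of each group pays for its own share of the deficit.\<close>
    have term_le: "(s j)\<^sup>2 + \<theta> * (w j - s j) \<le> s j * w j + \<theta> * (D - min D (s j))" if "j < J" for j
    proof -
      have j: "0 \<le> s j" "s j \<le> w j" using sw that by auto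
      have "w j - s j \<le> (\<Sum>j<J. w j - s j)"
        using that sw by (intro member_le_sum) auto
      then have t: "w j - s j \<le> \<theta>" using tight(1) by simp
      have "(\<theta> - s j) * (w j - s j) \<le> \<theta> * (D - min D (s j))"
      proof (cases "\<theta> \<le> s j")
        case True
        then have "(\<theta> - s j) * (w j - s j) \<le> 0"
          using j by (intro mult_nonpos_nonneg) auto
        also have "0 \<le> \<theta> * (D - min D (s j))" using \<theta> by simp
        finally show ?thesis .
      next
        case False
        then have "(\<theta> - s j) * (w j - s j) \<le> (D - min D (s j)) * \<theta>"
          using j t \<theta> by (intro mult_mono) auto
        then show ?thesis by (simp add: mult.commute)
      qed
      then show ?thesis by (simp add: algebra_simps power2_eq_square)
    qed
    have "(\<Sum>j<J. (s j)\<^sup>2) + \<theta> * (\<Sum>j<J. w j - s j)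
        = (\<Sum>j<J. (s j)\<^sup>2 + \<theta> * (w j - s j))"
      by (simp add: sum.distrib sum_distrib_left)
    also have "\<dots> \<le> (\<Sum>j<J. s j * w j + \<theta> * (D - min D (s j)))"
      by (intro sum_mono term_le) auto
    also have "\<dots> = (\<Sum>j<J. s j * w j) + \<theta> * (int J * D - (\<Sum>j<J. min D (s j)))"
      by (simp add: sum.distrib sum_subtractf flip: sum_distrib_left)
    finally have 1: "(\<Sum>j<J. (s j)\<^sup>2) + \<theta> * (\<Sum>j<J. w j - s j)
      \<le> (\<Sum>j<J. s j * w j) + \<theta> * (int J * D - (\<Sum>j<J. min D (s j)))" .
    \<comment> \<open>Adding \<open>1\<close> and \<open>2\<close> cancels the sum of the
      \<open>w j - s j\<close> and the sum of the minima.\<close>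
    have 2: "\<theta> * n \<le> \<theta> * (v + (\<Sum>j<J. w j - s j) + (\<Sum>j<J. min D (s j)))"
      using cover[OF tight(2)] \<theta>(1) by (rule mult_left_mono)
    show ?thesis
      using 1 2 sum_s by (intro exI[of _ \<theta>] exI[of _ s]) (simp add: algebra_simps)
  next
    case small
    have "n - \<theta> \<le> (\<Sum>j<J. v)"
      unfolding sum_s[symmetric] using sw by (intro sum_mono) (auto intro: order_trans)
    then have v: "n - \<theta> \<le> int J * v" by simp
    have "n - \<theta> \<le> (\<Sum>j<J. D)"
      unfolding sum_s[symmetric] using small by (intro sum_mono) auto
    \<comment> \<open>With \<open>A = n - D * J\<close>, this yields
      \<open>J * v \<ge> n - D = A + (J - 1) * D \<ge> J * A\<close>.\<close>
    then have A: "n - D * int J \<le> D" using \<theta> by (simp add: mult.commute)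
    have "(int J - 1) * (n - D * int J) \<le> (int J - 1) * D"
      using A J by (intro mult_left_mono) auto
    then have "int J * (n - D * int J) \<le> int J * v"
      using v \<theta> by (simp add: algebra_simps)
    then have "n - D * int J \<le> v" using J by simp
    then have "(n - D * int J) * \<theta> \<le> v * \<theta>" using \<theta>(1) by (rule mult_right_mono)
    moreover have "(\<Sum>j<J. (s j)\<^sup>2) \<le> (\<Sum>j<J. s j * w j)"
      unfolding power2_eq_square using sw by (intro sum_mono mult_left_mono) auto
    ultimately show ?thesis
      using sum_s by (intro exI[of _ \<theta>] exI[of _ s]) simp
  qed
qed

section \<open>Covering by increments, overlaps and private symbols\<close>

lemma sum_UN_increments:
  fixes A :: "nat \<Rightarrow> 'b set" and g :: "'b \<Rightarrow> 'c::comm_monoid_add"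
  assumes "\<And>j. finite (A j)"
  shows "sum g (\<Union>j<J. A j) = (\<Sum>j<J. sum g (A j - (\<Union>i<j. A i)))"
proof (induction J)
  case (Suc J)
  have "(\<Union>j<Suc J. A j) = (\<Union>j<J. A j) \<union> (A J - (\<Union>j<J. A j))"
    by (auto simp: less_Suc_eq)
  then have "sum g (\<Union>j<Suc J. A j) = sum g (\<Union>j<J. A j) + sum g (A J - (\<Union>j<J. A j))"
    using assms by (simp only:) (rule sum.union_disjoint; auto)
  then show ?case using Suc by simp
qed simp

text \<open>A symbol outside \<open>A J\<close> is uncovered, private to one set, or shared by two
  of the first \<open>J\<close> sets and so counted as an overlap at the later one.\<close>

lemma card_le_last_plus_overlaps_plus_private:
  fixes A :: "nat \<Rightarrow> 'n::finite set"
  assumes large: "\<And>j. j < J \<Longrightarrow> CARD('n) \<le> card (\<Union>i\<in>{..J} - {j}. A i) + D"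
    and j0: "j0 < J" "D \<le> card (A j0 - (\<Union>i<j0. A i))"
  shows "CARD('n) \<le> card (A J) + (\<Sum>j<J. card (A j \<inter> (\<Union>i<j. A i)))
    + (\<Sum>j<J. min D (card (A j - (\<Union>i<j. A i))))"
proof -
  define P where "P j = A j - (\<Union>i\<in>{..J} - {j}. A i)" for j
  define Z where "Z = - (\<Union>i\<le>J. A i)"
  have PZ: "card (P j) + card Z \<le> D" if "j < J" for j
  proof -
    have "card (P j) + card Z = card (P j \<union> Z)"
      using that by (subst card_Un_disjoint) (auto simp: P_def Z_def)
    also have "\<dots> \<le> card (- (\<Union>i\<in>{..J} - {j}. A i))"
      by (rule card_mono) (auto simp: P_def Z_def)
    also have "\<dots> = CARD('n) - card (\<Union>i\<in>{..J} - {j}. A i)"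
      by (simp add: Compl_eq_Diff_UNIV card_Diff_subset)
    finally show ?thesis using large[OF that] by linarith
  qed
  have P_min: "card (P j) \<le> min D (card (A j - (\<Union>i<j. A i)))" if "j < J" for j
    using PZ[OF that] that by (auto simp: P_def intro!: card_mono)
  \<comment> \<open>The uncovered symbols are charged to \<open>j0\<close>, whose minimum is the
    full \<open>D\<close>.\<close>
  have "(\<Sum>j<J. card (P j)) + card Z = (\<Sum>j\<in>{..<J} - {j0}. card (P j)) + (card (P j0) + card Z)"
    using j0 by (simp add: sum.remove[of _ j0])
  also have "\<dots> \<le> (\<Sum>j\<in>{..<J} - {j0}. min D (card (A j - (\<Union>i<j. A i))))
      + min D (card (A j0 - (\<Union>i<j0. A i)))"
    using P_min PZ j0 by (intro add_mono sum_mono) auto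
  also have "\<dots> = (\<Sum>j<J. min D (card (A j - (\<Union>i<j. A i))))"
    using j0 by (simp add: sum.remove[of _ j0])
  finally have PZ_sum: "(\<Sum>j<J. card (P j)) + card Z \<le> (\<Sum>j<J. min D (card (A j - (\<Union>i<j. A i))))" .
  have "x \<in> Z \<union> A J \<union> (\<Union>j<J. A j \<inter> (\<Union>i<j. A i)) \<union> (\<Union>j<J. P j)" for x
  proof (cases "x \<in> Z \<union> A J \<union> (\<Union>j<J. P j)")
    case False
    then obtain i where i: "i < J" "x \<in> A i" "x \<notin> P i"
      by (auto simp: Z_def order_le_less)
    then obtain i' where i': "i' \<le> J" "x \<in> A i'" "i' \<noteq> i"
      by (auto simp: P_def)
    then have "i' < J" using False by (cases "i' = J") auto
    then show ?thesis
      using i i' by (cases i i' rule: linorder_cases) auto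
  qed blast
  then have "CARD('n) \<le> card (Z \<union> A J \<union> (\<Union>j<J. A j \<inter> (\<Union>i<j. A i)) \<union> (\<Union>j<J. P j))"
    by (intro card_mono) auto
  also have "\<dots> \<le> card Z + card (A J) + card (\<Union>j<J. A j \<inter> (\<Union>i<j. A i)) + card (\<Union>j<J. P j)"
    by (meson add_mono card_Un_le order_refl order_trans)
  also have "\<dots> \<le> card Z + card (A J) + (\<Sum>j<J. card (A j \<inter> (\<Union>i<j. A i))) + (\<Sum>j<J. card (P j))"
    by (intro add_mono card_UN_le) auto
  finally show ?thesis using PZ_sum by linarith
qed

section \<open>Cost of the greedy cover and the final bound\<close>

lemma sum_locality_lower_bound:
  fixes C :: "('a::field ^ 'n) set"
  assumes C: "vec.subspace C" "1 \<le> vec.dim C" "2 \<le> min_distance C"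
    and J: "J + vec.dim C + min_distance C = CARD('n) + 2"
  defines "D \<equiv> min_distance C - 2"
  shows "\<exists>\<theta>\<le>D. \<exists>s :: nat \<Rightarrow> int. (\<Sum>j<J. s j) = int CARD('n) - int \<theta> \<and>
    (\<Sum>j<J. (s j)\<^sup>2) + (int CARD('n) - int D * int J) * int \<theta>
      \<le> (\<Sum>i\<in>(UNIV :: 'n set). int (locality C i) + 1)"
proof -
  let ?n = "CARD('n)"
  have J1: "J \<ge> 1" using singleton_bound[of C] C J by simp
  define w where "w i = locality C i + 1" for i
  from repair_set_exists[OF C(1,3)] obtain I where
    I: "\<And>i. I i \<subseteq> UNIV - {i}" "\<And>i. card (I i) = locality C i"
      "\<And>i. \<exists>\<alpha> :: 'n \<Rightarrow> 'a. \<forall>y\<in>C. y $ i = (\<Sum>l\<in>I i. \<alpha> l * y $ l)"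
    by metis
  define R where "R i = insert i (I i)" for i
  have R_self: "i \<in> R i" for i by (simp add: R_def)
  have R_card: "card (R i) = w i" for i
    using I(1)[of i] I(2)[of i] by (auto simp: R_def w_def card_insert_if)
  have R_rec: "y $ i = 0" if "y \<in> C" "\<forall>l\<in>R i - {i}. y $ l = 0" for i y
  proof -
    obtain \<alpha> :: "'n \<Rightarrow> 'a" where "\<forall>y\<in>C. y $ i = (\<Sum>l\<in>I i. \<alpha> l * y $ l)"
      using I(3)[of i] by (rule exE)
    then have "y $ i = (\<Sum>l\<in>I i. \<alpha> l * y $ l)" using that(1) by simp
    also have "\<dots> = 0" using I(1)[of i] that by (intro sum.neutral) (auto simp: R_def)
    finally show ?thesis .
  qed
  obtain p :: "nat \<Rightarrow> 'n" where
    p: "\<And>j x. x \<notin> (\<Union>i<j. R (p i)) \<Longrightarrow> p j \<notin> (\<Union>i<j. R (p i)) \<and> w (p j) \<le> w x"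
    using greedy_sequence_exists[of R w] by blast
  define U where "U j = (\<Union>i<j. R (p i))" for j
  have U_mono: "U i \<subseteq> U j" if "i \<le> j" for i j
    unfolding U_def using that by (intro UN_mono) auto
  define s where "s j = card (R (p j) - U j)" for j
  have s_le: "s j \<le> w (p j)" for j
    unfolding s_def R_card[symmetric] by (rule card_mono) auto
  have w_le: "w (p j) \<le> w x" if "x \<notin> U j" for j x
    using p[of x j] that by (simp add: U_def)
  have sum_s: "(\<Sum>j<J. s j) = card (U J)"
    using sum_UN_increments[of "\<lambda>j. R (p j)" "\<lambda>_. 1 :: nat" J] by (simp add: U_def s_def)
  have "(\<Sum>i\<in>UNIV. w i) = (\<Sum>i\<in>U J. w i) + (\<Sum>i\<in>- U J. w i)"
    by (metis Compl_eq_Diff_UNIV add.commute finite sum.subset_diff top_greatest)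
  also have "(\<Sum>i\<in>U J. w i) = (\<Sum>j<J. \<Sum>i\<in>R (p j) - U j. w i)"
    using sum_UN_increments[of "\<lambda>j. R (p j)" w J] by (simp add: U_def)
  finally have total: "(\<Sum>i\<in>UNIV. w i) = (\<Sum>j<J. \<Sum>i\<in>R (p j) - U j. w i) + (\<Sum>i\<in>- U J. w i)" .
  \<comment> \<open>Symbols new at stage \<open>j\<close> were still available, so none has a
    smaller \<open>w\<close> than \<open>p j\<close>.\<close>
  have "(\<Sum>j<J. s j * w (p j)) \<le> (\<Sum>j<J. \<Sum>i\<in>R (p j) - U j. w i)"
  proof (intro sum_mono)
    fix j
    have "s j * w (p j) = (\<Sum>i\<in>R (p j) - U j. w (p j))" by (simp add: s_def)
    also have "\<dots> \<le> (\<Sum>i\<in>R (p j) - U j. w i)" by (intro sum_mono w_le) auto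
    finally show "s j * w (p j) \<le> (\<Sum>i\<in>R (p j) - U j. w i)" .
  qed
  moreover have "w (p J) * card (- U J) \<le> (\<Sum>i\<in>- U J. w i)"
    using sum_bounded_below[of "- U J" "w (p J)" w] w_le by (simp add: mult.commute)
  ultimately have cost: "(\<Sum>j<J. s j * w (p j)) + w (p J) * card (- U J) \<le> (\<Sum>i\<in>UNIV. w i)"
    using total by linarith
  have card_compl: "card (- U J) + card (U J) = ?n"
    by (metis Compl_eq_Diff_UNIV card_Diff_subset card_mono finite le_add_diff_inverse2 top_greatest)
  have "int (\<Sum>i\<in>UNIV. w i) = (\<Sum>i\<in>(UNIV :: 'n set). int (locality C i) + 1)"
    by (simp add: w_def add.commute)
  then have cost_int: "(\<Sum>j<J. int (s j) * int (w (p j))) + int (w (p J)) * int (card (- U J))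
      \<le> (\<Sum>i\<in>(UNIV :: 'n set). int (locality C i) + 1)"
    using cost[folded of_nat_le_iff[where 'a = int]] by simp
  show ?thesis
  proof (cases "U J = UNIV")
    \<comment> \<open>Here \<open>p J\<close> carries no information, and the sizes
      \<open>s j\<close> already witness the bound at \<open>0\<close>.\<close>
    case True
    have "(\<Sum>j<J. (int (s j))\<^sup>2) \<le> (\<Sum>j<J. int (s j) * int (w (p j)))"
      unfolding power2_eq_square using s_le by (intro sum_mono mult_left_mono) auto
    moreover have "(\<Sum>j<J. int (s j)) = int ?n" using sum_s True by (simp flip: of_nat_sum)
    ultimately show ?thesis
      using cost_int True by (intro exI[of _ 0] conjI exI[of _ "\<lambda>j. int (s j)"]) auto
  next
    case False
    then have new: "p j \<notin> U j" if "j \<le> J" for j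
      using p[of _ j] U_mono[OF that] by (auto simp: U_def)
    have pivot: "p j \<notin> R (p i)" if "i < j" "j \<le> J" for i j
      using new[OF that(2)] that(1) by (auto simp: U_def)
    \<comment> \<open>Any \<open>J\<close> of the \<open>J + 1\<close> checks qualify: the first
      \<open>J\<close> bound the leftover by \<open>D\<close>, and dropping one of them serves
      \<open>cover\<close>.\<close>
    have large: "?n \<le> card (\<Union>j\<in>K. R (p j)) + D" if "K \<subseteq> {..J}" "card K = J" for K
    proof -
      have "?n + 2 \<le> card (\<Union>j\<in>K. R (p j)) + min_distance C"
      proof (rule card_union_parity_checks[OF C(1,2) _ R_self R_rec])
        show "p j \<notin> R (p i)" if "i \<in> K" "j \<in> K" "i < j" for i j
          using pivot[of i j] that \<open>K \<subseteq> {..J}\<close> by auto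
      qed (use C(3) J that finite_subset[OF that(1)] in auto)
      then show ?thesis using C(3) by (simp add: D_def)
    qed
    have \<theta>: "card (- U J) \<le> D"
      using large[of "{..<J}", folded U_def] card_compl by force
    have cover: "?n \<le> w (p J) + (\<Sum>j<J. w (p j) - s j) + (\<Sum>j<J. min D (s j))"
      if "j0 < J" "D \<le> s j0" for j0
    proof -
      have "w (p j) - s j = card (R (p j) \<inter> U j)" for j
        by (metis R_card card_Diff_subset_Int card_mono diff_diff_cancel finite finite_Int
            inf_le1 s_def)
      then show ?thesis
        using card_le_last_plus_overlaps_plus_private[of J "\<lambda>j. R (p j)" D j0] that large
        by (simp add: R_card s_def U_def)
    qed
    have "\<exists>\<theta> s'. \<theta> \<in> {0, int (card (- U J))} \<and> (\<Sum>j<J. s' j) = int ?n - \<theta> \<and>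
      (\<Sum>j<J. (s' j)\<^sup>2) + (int ?n - int D * int J) * \<theta>
        \<le> (\<Sum>j<J. int (s j) * int (w (p j))) + int (w (p J)) * int (card (- U J))"
    proof (rule group_cost_lower_bound[OF J1])
      show "0 \<le> int (s j) \<and> int (s j) \<le> int (w (p j)) \<and> int (w (p j)) \<le> int (w (p J))"
        if "j < J" for j
        using s_le w_le[of "p J" j] new[of J] U_mono[of j J] that by auto
      show "(\<Sum>j<J. int (s j)) = int ?n - int (card (- U J))"
        using sum_s card_compl by (simp flip: of_nat_sum)
      show "int ?n \<le> int (w (p J)) + (\<Sum>j<J. int (w (p j)) - int (s j))
          + (\<Sum>j<J. min (int D) (int (s j)))" if "\<exists>j<J. int D \<le> int (s j)"
      proof -
        have "?n \<le> w (p J) + (\<Sum>j<J. w (p j) - s j) + (\<Sum>j<J. min D (s j))"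
          using that cover by auto
        from this[folded of_nat_le_iff[where 'a = int]] show ?thesis
          by (simp add: of_nat_diff s_le of_nat_min)
      qed
    qed (use \<theta> in auto)
    then obtain t s' where t: "t \<in> {0, int (card (- U J))}"
      and s': "(\<Sum>j<J. s' j) = int ?n - t"
        "(\<Sum>j<J. (s' j)\<^sup>2) + (int ?n - int D * int J) * t
          \<le> (\<Sum>j<J. int (s j) * int (w (p j))) + int (w (p J)) * int (card (- U J))"
      by (elim exE conjE)
    from t \<theta> have nat_t: "nat t \<le> D" "int (nat t) = t" by auto
    show ?thesis
      using nat_t(1) s'(1) order_trans[OF s'(2) cost_int]
      by (intro exI[of _ "nat t"] conjI exI[of _ s']) (simp_all only: nat_t(2))
  qed
qed

theorem theorem2:
  fixes C :: "('a::{field,finite} ^ 'n) set" and k d :: nat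
  assumes "vec.subspace C"
    and "vec.dim C = k" and "k \<ge> 1"
    and "min_distance C = d" and "d \<ge> 2"
    and "real k / real CARD('n) > (1 - 1 / sqrt (real CARD('n)))\<^sup>2"
  shows "let n = int CARD('n); J = n - int k - int d + 2;
             a = (\<lambda>\<theta>::nat. n - int \<theta> + J - J * \<lceil>real_of_int (n - int \<theta>) / real_of_int J\<rceil>)
         in avg_locality C \<ge>
            (1 / real_of_int n) *
              Min ((\<lambda>\<theta>. real_of_int
                  ((J - a \<theta>) * \<lfloor>real_of_int (n - int \<theta>) / real_of_int J\<rfloor>\<^sup>2
                   + a \<theta> * \<lceil>real_of_int (n - int \<theta>) / real_of_int J\<rceil>\<^sup>2
                   + (n - int d * J + 2 * J) * int \<theta>)) ` {0..d - 2})
            - 1"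
proof -
  let ?n = "CARD('n)"
  \<comment> \<open>Adding 2 first keeps the natural subtraction exact, since
    \<open>k + d \<le> n + 1\<close>.\<close>
  define J where "J = ?n + 2 - k - d"
  have kd: "k + d \<le> ?n + 1" using singleton_bound[of C] assms by simp
  then have J: "int ?n - int k - int d + 2 = int J" "J \<ge> 1" by (auto simp: J_def)
  obtain \<theta> s where \<theta>: "\<theta> \<le> d - 2" and s: "(\<Sum>j<J. s j) = int ?n - int \<theta>"
    "(\<Sum>j<J. (s j)\<^sup>2) + (int ?n - int (d - 2) * int J) * int \<theta>
      \<le> (\<Sum>i\<in>(UNIV :: 'n set). int (locality C i) + 1)"
    using sum_locality_lower_bound[of C J] assms kd unfolding J_def by auto
  define F where "F \<theta> = (int J - (int ?n - int \<theta> + int J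
        - int J * \<lceil>real_of_int (int ?n - int \<theta>) / real_of_int (int J)\<rceil>))
      * \<lfloor>real_of_int (int ?n - int \<theta>) / real_of_int (int J)\<rfloor>\<^sup>2
    + (int ?n - int \<theta> + int J
        - int J * \<lceil>real_of_int (int ?n - int \<theta>) / real_of_int (int J)\<rceil>)
      * \<lceil>real_of_int (int ?n - int \<theta>) / real_of_int (int J)\<rceil>\<^sup>2
    + (int ?n - int d * int J + 2 * int J) * int \<theta>" for \<theta> :: nat
  have coeff: "int ?n - int (d - 2) * int J = int ?n - int d * int J + 2 * int J"
    using assms(5) by (simp add: of_nat_diff algebra_simps)
  have "F \<theta> \<le> (\<Sum>i\<in>(UNIV :: 'n set). int (locality C i) + 1)"
    using balanced_square_sum_le[OF J(2) s(1)] s(2) unfolding F_def coeff by simp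
  then have "real_of_int (F \<theta>) \<le> real_of_int (\<Sum>i\<in>(UNIV :: 'n set). int (locality C i) + 1)"
    by (simp only: of_int_le_iff)
  \<comment> \<open>The extra 1 per symbol becomes the final \<open>- 1\<close> after division by
    the length.\<close>
  also have "\<dots> = (\<Sum>i\<in>(UNIV :: 'n set). real (locality C i)) + real ?n"
    by (simp add: sum.distrib)
  finally have F: "real_of_int (F \<theta>) \<le> (\<Sum>i\<in>(UNIV :: 'n set). real (locality C i)) + real ?n" .
  have "Min ((\<lambda>\<theta>. real_of_int (F \<theta>)) ` {0..d - 2}) \<le> real_of_int (F \<theta>)"
    using \<theta> by (intro Min_le) auto
  with F have "1 / real ?n * Min ((\<lambda>\<theta>. real_of_int (F \<theta>)) ` {0..d - 2})
      \<le> 1 / real ?n * ((\<Sum>i\<in>(UNIV :: 'n set). real (locality C i)) + real ?n)"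
    by (intro mult_left_mono) auto
  also have "\<dots> = avg_locality C + 1"
    by (simp add: avg_locality_def field_simps)
  finally show ?thesis
    unfolding Let_def J(1) F_def by simp
qed

end
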